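(* Let $(V,\mathcal{B})$ be a $d$-partite hypergraph with a given $d$-partition $V_1,\ldots,V_d$, let $c\in\mathbb{R}_{\ge0}^V$ be vertex costs, and let $x$ be a fractional vertex cover. There is a randomized linear-time algorithm that computes an integral solution $\bar x\in\{0,1\}^V$ (a vertex cover, i.e. $\sum_{v\in P}\bar x_v\ge1$ for all $P\in\mathcal{B}$) of expected cost $\mathbb{E}[\sum_{v\in V}c_v\bar x_v]\le\frac d2\sum_{v\in V}c_vx_v$.
   Context: A hypergraph $(V,\mathcal{B})$ is $d$-partite if there is a partition $V=V_1\dot\cup\cdots\dot\cup V_d$ (a $d$-partition) with $|P\cap V_i|\le1$ for all $P\in\mathcal{B}$ and all $i$; the hypergraph need not be uniform. A fractional vertex cover is a vector $x\in\mathbb{R}_{\ge0}^V$ with $\sum_{v\in P}x_v\ge1$ for all $P\in\mathcal{B}$. The algorithm receives $V$, the $d$-partition, $c$ and $x$ (not necessarily an explicit list of hyperedges).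
   Formalization: The formal statement assumes d ≥ 2; for d = 1 the claim fails (V = {v}, one hyperedge {v}, c = x = 1: every cover costs 1 > 1/2). Vertices are encoded as natural numbers. *)

theory Defs
  imports "HOL-Probability.Probability"
begin


definition hypergraph :: "'v set \<Rightarrow> 'v set set \<Rightarrow> bool" where
  "hypergraph V B \<longleftrightarrow> finite V \<and> (\<forall>P\<in>B. P \<subseteq> V)"

text \<open>Parts may be empty.\<close>

definition d_partition :: "nat \<Rightarrow> 'v set \<Rightarrow> 'v set set \<Rightarrow> (nat \<Rightarrow> 'v set) \<Rightarrow> bool" where
  "d_partition d V B Vs \<longleftrightarrow>
     V = (\<Union>i\<in>{1..d}. Vs i) \<and> disjoint_family_on Vs {1..d} \<and>
     (\<forall>P\<in>B. \<forall>i\<in>{1..d}. card (P \<inter> Vs i) \<le> 1)"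

definition fractional_vertex_cover :: "'v set \<Rightarrow> 'v set set \<Rightarrow> ('v \<Rightarrow> real) \<Rightarrow> bool" where
  "fractional_vertex_cover V B x \<longleftrightarrow>
     (\<forall>v\<in>V. 0 \<le> x v) \<and> (\<forall>P\<in>B. 1 \<le> (\<Sum>v\<in>P. x v))"

definition integral_vertex_cover :: "'v set \<Rightarrow> 'v set set \<Rightarrow> ('v \<Rightarrow> real) \<Rightarrow> bool" where
  "integral_vertex_cover V B y \<longleftrightarrow>
     (\<forall>v\<in>V. y v \<in> {0, 1}) \<and> (\<forall>P\<in>B. 1 \<le> (\<Sum>v\<in>P. y v))"



text \<open>
  Programs are finite syntax trees over integer (natural number) and real variables and arrays.
  Every operation has unit cost.  Integers admit only addition and truncated subtraction, reals
  the four field operations (division by zero yields zero); there is no rounding from reals to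
  integers and there are no literal real constants, so a program cannot hide
  information in a constant or exploit unit-cost arithmetic on long integers.
\<close>

type_synonym vname = string

datatype iexp =
    INum nat
  | IVar vname
  | IGet vname iexp
  | IAdd iexp iexp
  | ISub iexp iexp

datatype rexp =
    ROfNat iexp
  | RVar vname
  | RGet vname iexp
  | RAdd rexp rexp
  | RSub rexp rexp
  | RMul rexp rexp
  | RDiv rexp rexp

datatype bexp =
    ILess iexp iexp
  | RLess rexp rexp
  | BNot bexp
  | BAnd bexp bexp

datatype com =
    Skip
  | IAssign vname iexp
  | RAssign vname rexp
  | IPut vname iexp iexp
  | RPut vname iexp rexp
  | Sample vname
  | Seq com com
  | If bexp com com
  | While bexp com

text \<open>The field \<open>tape\<close> holds the random numbers that have not been drawn yet.\<close>

record state =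
  ivar :: "vname \<Rightarrow> nat"
  rvar :: "vname \<Rightarrow> real"
  iarr :: "vname \<Rightarrow> nat \<Rightarrow> nat"
  rarr :: "vname \<Rightarrow> nat \<Rightarrow> real"
  tape :: "real stream"

primrec ival :: "iexp \<Rightarrow> state \<Rightarrow> nat" where
  "ival (INum k) s = k"
| "ival (IVar a) s = ivar s a"
| "ival (IGet a e) s = iarr s a (ival e s)"
| "ival (IAdd e f) s = ival e s + ival f s"
| "ival (ISub e f) s = ival e s - ival f s"

primrec rval :: "rexp \<Rightarrow> state \<Rightarrow> real" where
  "rval (ROfNat e) s = real (ival e s)"
| "rval (RVar a) s = rvar s a"
| "rval (RGet a e) s = rarr s a (ival e s)"
| "rval (RAdd e f) s = rval e s + rval f s"
| "rval (RSub e f) s = rval e s - rval f s"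
| "rval (RMul e f) s = rval e s * rval f s"
| "rval (RDiv e f) s = rval e s / rval f s"

primrec bval :: "bexp \<Rightarrow> state \<Rightarrow> bool" where
  "bval (ILess e f) s \<longleftrightarrow> ival e s < ival f s"
| "bval (RLess e f) s \<longleftrightarrow> rval e s < rval f s"
| "bval (BNot b) s \<longleftrightarrow> \<not> bval b s"
| "bval (BAnd b b') s \<longleftrightarrow> bval b s \<and> bval b' s"

primrec icost :: "iexp \<Rightarrow> nat" where
  "icost (INum k) = 1"
| "icost (IVar a) = 1"
| "icost (IGet a e) = 1 + icost e"
| "icost (IAdd e f) = 1 + icost e + icost f"
| "icost (ISub e f) = 1 + icost e + icost f"

primrec rcost :: "rexp \<Rightarrow> nat" where
  "rcost (ROfNat e) = 1 + icost e"
| "rcost (RVar a) = 1"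
| "rcost (RGet a e) = 1 + icost e"
| "rcost (RAdd e f) = 1 + rcost e + rcost f"
| "rcost (RSub e f) = 1 + rcost e + rcost f"
| "rcost (RMul e f) = 1 + rcost e + rcost f"
| "rcost (RDiv e f) = 1 + rcost e + rcost f"

primrec bcost :: "bexp \<Rightarrow> nat" where
  "bcost (ILess e f) = 1 + icost e + icost f"
| "bcost (RLess e f) = 1 + rcost e + rcost f"
| "bcost (BNot b) = 1 + bcost b"
| "bcost (BAnd b b') = 1 + bcost b + bcost b'"

text \<open>\<open>exec p s t s'\<close>: started in \<open>s\<close>, program \<open>p\<close> halts in \<open>s'\<close> after \<open>t\<close> elementary operations.\<close>

inductive exec :: "com \<Rightarrow> state \<Rightarrow> nat \<Rightarrow> state \<Rightarrow> bool" where
  Skip: "exec Skip s 1 s"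
| IAssign: "exec (IAssign a e) s (1 + icost e) (s\<lparr>ivar := (ivar s)(a := ival e s)\<rparr>)"
| RAssign: "exec (RAssign a e) s (1 + rcost e) (s\<lparr>rvar := (rvar s)(a := rval e s)\<rparr>)"
| IPut: "exec (IPut a i e) s (1 + icost i + icost e)
           (s\<lparr>iarr := (iarr s)(a := (iarr s a)(ival i s := ival e s))\<rparr>)"
| RPut: "exec (RPut a i e) s (1 + icost i + rcost e)
           (s\<lparr>rarr := (rarr s)(a := (rarr s a)(ival i s := rval e s))\<rparr>)"
| Sample: "exec (Sample a) s 1
             (s\<lparr>rvar := (rvar s)(a := shd (tape s)), tape := stl (tape s)\<rparr>)"
| Seq: "exec p s t s' \<Longrightarrow> exec q s' t' s'' \<Longrightarrow> exec (Seq p q) s (t + t') s''"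
| IfTrue: "bval b s \<Longrightarrow> exec p s t s' \<Longrightarrow> exec (If b p q) s (1 + bcost b + t) s'"
| IfFalse: "\<not> bval b s \<Longrightarrow> exec q s t s' \<Longrightarrow> exec (If b p q) s (1 + bcost b + t) s'"
| WhileFalse: "\<not> bval b s \<Longrightarrow> exec (While b p) s (1 + bcost b) s"
| WhileTrue: "bval b s \<Longrightarrow> exec p s t s' \<Longrightarrow> exec (While b p) s' t' s'' \<Longrightarrow>
                exec (While b p) s (1 + bcost b + t + t') s''"

inductive_cases exec_elims:
  "exec Skip s t s'" "exec (IAssign a e) s t s'" "exec (RAssign a r) s t s'"
  "exec (IPut a i e) s t s'" "exec (RPut a i r) s t s'" "exec (Sample a) s t s'"

inductive_cases exec_SeqE: "exec (Seq p q) s t s'"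
inductive_cases exec_IfE: "exec (If b p q) s t s'"
inductive_cases exec_WhileE: "exec (While b p) s t s'"

lemma exec_deterministic:
  "exec p s t s' \<Longrightarrow> exec p s u s'' \<Longrightarrow> u = t \<and> s'' = s'"
proof (induction arbitrary: u s'' rule: exec.induct)
  case (Seq p s t s' q t' s2)
  from Seq.prems obtain t1 t2 s1 where *: "exec p s t1 s1" "exec q s1 t2 s''" "u = t1 + t2"
    by (rule exec_SeqE)
  from Seq.IH(1)[OF *(1)] * Seq.IH(2)[of t2 s''] show ?case by simp
next
  case (IfTrue b s p t s' q)
  from IfTrue.prems IfTrue.hyps(1) obtain t1 where "u = 1 + bcost b + t1" "exec p s t1 s''"
    by (auto elim: exec_IfE)
  with IfTrue.IH show ?case by simp
next
  case (IfFalse b s q t s' p)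
  from IfFalse.prems IfFalse.hyps(1) obtain t1 where "u = 1 + bcost b + t1" "exec q s t1 s''"
    by (auto elim: exec_IfE)
  with IfFalse.IH show ?case by simp
next
  case (WhileFalse b s p)
  from WhileFalse.prems WhileFalse.hyps show ?case
    by (auto elim: exec_WhileE)
next
  case (WhileTrue b s p t s' t' s2)
  from WhileTrue.prems WhileTrue.hyps(1) obtain t1 s1 t2
    where *: "u = 1 + bcost b + t1 + t2" "exec p s t1 s1" "exec (While b p) s1 t2 s''"
    by (auto elim: exec_WhileE)
  from WhileTrue.IH(1)[OF *(2)] * WhileTrue.IH(2)[of t2 s''] show ?case by simp
qed (erule exec_elims; simp)+

text \<open>
  The source of randomness: independent draws from the uniform distribution on \<open>[0,1]\<close>.  Its
  space consists of all streams with entries in \<open>[0,1]\<close>.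
\<close>

definition random_tape :: "real stream measure" where
  "random_tape = stream_space (restrict_space lborel {0..1})"

text \<open>
  The vertices are presented to the program in the order of the list \<open>vs\<close>; \<open>part\<close> stores for each
  position the number of the class that contains the vertex.  The hyperedges are not part of the
  input.  All cells not occupied by the input are zero.
\<close>

definition input_state ::
  "nat \<Rightarrow> 'v list \<Rightarrow> (nat \<Rightarrow> 'v set) \<Rightarrow> ('v \<Rightarrow> real) \<Rightarrow> ('v \<Rightarrow> real) \<Rightarrow> real stream \<Rightarrow> state" where
  "input_state d vs Vs c x \<omega> =
     \<lparr> ivar = (\<lambda>_. 0)(''n'' := length vs, ''d'' := d),
       rvar = (\<lambda>_. 0),
       iarr = (\<lambda>_ _. 0)(''part'' :=
         (\<lambda>j. if j < length vs then (THE i. i \<in> {1..d} \<and> vs ! j \<in> Vs i) else 0)),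
       rarr = (\<lambda>_ _. 0)(
         ''c'' := (\<lambda>j. if j < length vs then c (vs ! j) else 0),
         ''x'' := (\<lambda>j. if j < length vs then x (vs ! j) else 0)),
       tape = \<omega> \<rparr>"

text \<open>The output is read off the integer array \<open>xbar\<close>.\<close>

definition outputs :: "state \<Rightarrow> 'v list \<Rightarrow> ('v \<Rightarrow> real) \<Rightarrow> bool" where
  "outputs s vs y \<longleftrightarrow> (\<forall>j<length vs. y (vs ! j) = real (iarr s ''xbar'' j))"

end

theory Submission imports Defs begin

text \<open>
  This is Lovasz's threshold rounding.  If random thresholds \<open>t\<^sub>1, \<dots>, t\<^sub>d\<close> are each uniform on
  \<open>[0, 2/d]\<close> and always sum to \<open>1\<close>, then rounding \<open>x v\<close> up exactly when it reaches the threshold of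
  the class of \<open>v\<close> yields a cover: an uncovered hyperedge would have \<open>x\<close>-weight below \<open>1\<close>.  A vertex
  is picked with probability at most \<open>d/2 * x v\<close>.  Rescaled to \<open>[0,1]\<close>, the thresholds come from one
  uniform number \<open>u\<close>: the classes are paired off and receive \<open>u\<close> and \<open>1 - u\<close>.  If \<open>d\<close> is odd, three
  classes instead receive \<open>u\<close>, \<open>u + 1/2\<close> modulo \<open>1\<close>, and \<open>3/2\<close> minus these two, which is again
  uniform.
\<close>

section \<open>Thresholds\<close>

text \<open>Using the parity of \<open>d + i\<close>, not of \<open>i\<close>, pairs the classes
  from the top and makes the value depend on \<open>d\<close> only through its parity. The third
  class of the triple gets 3/2 minus the other two, computed separately on each half of
  [0,1].\<close>

definition threshold :: "nat \<Rightarrow> real \<Rightarrow> nat \<Rightarrow> real" where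
  "threshold d u i =
     (if odd d \<and> i \<le> 3 then
        (if i = 1 then u
         else if i = 2 then (if u < 1/2 then u + 1/2 else u - 1/2)
         else (if u < 1/2 then 1 - 2 * u else 2 - 2 * u))
      else if even (d + i) then u else 1 - u)"

lemma threshold_nonneg: "u \<in> {0..1} \<Longrightarrow> 0 \<le> threshold d u i"
  by (auto simp: threshold_def)

text \<open>Induction in steps of two: going from \<open>d - 2\<close> to \<open>d\<close> changes
  no earlier threshold, since parity is kept, and the two new classes contribute
  \<open>(1 - u) + u = 1\<close>.\<close>

lemma sum_threshold:
  assumes "d \<ge> 2"
  shows "(\<Sum>i\<in>{1..d}. threshold d u i) = real d / 2"
  using assms
proof (induction d rule: less_induct)
  case (less d)
  consider "d = 2" | "d = 3" | "d \<ge> 4" using less.prems by linarith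
  then show ?case
  proof cases
    case 3
    define e where "e = d - 2"
    have d: "d = Suc (Suc e)" and e: "e \<ge> 2" using 3 by (auto simp: e_def)
    have "(\<Sum>i\<in>{1..e}. threshold d u i) = (\<Sum>i\<in>{1..e}. threshold e u i)"
      by (rule sum.cong) (auto simp: threshold_def d)
    also have "\<dots> = real e / 2" using less.IH[of e] e d by simp
    finally show ?thesis using e
      by (auto simp: d threshold_def field_simps)
  next
    case 1
    have "{1..2} = {1, 2::nat}" by auto
    with 1 show ?thesis by (simp add: threshold_def)
  next
    case 2
    have "{1..3} = {1, 2, 3::nat}" by auto
    with 2 show ?thesis by (simp add: threshold_def)
  qed
qed

lemma measurable_threshold [measurable]: "(\<lambda>u. threshold d u i) \<in> borel_measurable borel"
  unfolding threshold_def by measurable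

text \<open>Meant for sublevel sets of a threshold: it is piecewise affine with at most two pieces
  on [0,1], so two intervals always suffice.\<close>

lemma measure_two_intervals_le:
  fixes A :: "real set"
  assumes A: "A \<subseteq> {p..q} \<union> {r..s}" and "A \<in> sets lborel" "p \<le> q" "r \<le> s"
  shows "measure lborel A \<le> (q - p) + (s - r)"
proof -
  have Icc: "{a..b} \<in> fmeasurable lborel" for a b :: real
    by (rule fmeasurableI) (auto simp: emeasure_lborel_Icc_eq)
  have "measure lborel A \<le> measure lborel ({p..q} \<union> {r..s})"
    by (rule measure_mono_fmeasurable) (use assms Icc in auto)
  also have "\<dots> \<le> measure lborel {p..q} + measure lborel {r..s}"
    by (rule measure_Un_le) auto
  finally show ?thesis using assms by simp
qed

lemma measure_threshold_le:
  assumes "0 \<le> a"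
  shows "measure lborel ({0..1} \<inter> {u. threshold d u i \<le> a}) \<le> a"
proof -
  define A where "A = {0..1} \<inter> {u. threshold d u i \<le> a}"
  have A: "A \<in> sets lborel" unfolding A_def by measurable
  \<comment> \<open>Which formula applies is decided by \<open>d\<close> and \<open>i\<close> alone,
    hence once for all \<open>u\<close>. The shifted variable needs a split at
    \<open>a = 1/2\<close>, where its sublevel set starts to wrap around.\<close>
  consider "a \<ge> 1" | "a < 1" "\<And>u. threshold d u i = u" | "a < 1" "\<And>u. threshold d u i = 1 - u"
    | "a < 1" "\<And>u. threshold d u i = (if u < 1/2 then u + 1/2 else u - 1/2)" "a < 1/2"
    | "a < 1" "\<And>u. threshold d u i = (if u < 1/2 then u + 1/2 else u - 1/2)" "a \<ge> 1/2"
    | "a < 1" "\<And>u. threshold d u i = (if u < 1/2 then 1 - 2 * u else 2 - 2 * u)"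
    unfolding threshold_def by (smt (verit))
  then have "measure lborel A \<le> a"
  proof cases
    case 1
    \<comment> \<open>The null set \<open>{1..1}\<close> pads a single interval to the required
      pair.\<close>
    then have "A \<subseteq> {0..1} \<union> {1..1}" by (auto simp: A_def split: if_splits)
    from measure_two_intervals_le[OF this A] show ?thesis using assms 1 by simp
  next
    case 2
    then have "A \<subseteq> {0..a} \<union> {1..1}" by (auto simp: A_def split: if_splits)
    from measure_two_intervals_le[OF this A] show ?thesis using assms 2 by simp
  next
    case 3
    then have "A \<subseteq> {1 - a..1} \<union> {1..1}" by (auto simp: A_def split: if_splits)
    from measure_two_intervals_le[OF this A] show ?thesis using assms 3 by simp
  next
    case 4
    then have "A \<subseteq> {1/2..1/2 + a} \<union> {1..1}" by (auto simp: A_def split: if_splits)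
    from measure_two_intervals_le[OF this A] show ?thesis using assms 4 by simp
  next
    case 5
    then have "A \<subseteq> {0..a - 1/2} \<union> {1/2..1}" by (auto simp: A_def split: if_splits)
    from measure_two_intervals_le[OF this A] show ?thesis using assms 5 by simp
  next
    case 6
    \<comment> \<open>The slope is -2 on each half of [0,1], so each half contributes length
      \<open>a/2\<close>.\<close>
    then have "A \<subseteq> {(1 - a)/2..1/2} \<union> {1 - a/2..1}" by (auto simp: A_def split: if_splits)
    from measure_two_intervals_le[OF this A] show ?thesis using assms by (simp add: field_simps)
  qed
  then show ?thesis by (simp add: A_def)
qed

section \<open>The random tape\<close>

lemma prob_space_unit_interval: "prob_space (restrict_space lborel {0..1::real})"
  by (rule prob_space_restrict_space) auto

lemma prob_space_random_tape: "prob_space random_tape"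
  unfolding random_tape_def
  by (rule prob_space.prob_space_stream_space[OF prob_space_unit_interval])

lemma shd_random_tape: "\<omega> \<in> space random_tape \<Longrightarrow> shd \<omega> \<in> {0..1}"
  unfolding random_tape_def space_stream_space space_restrict_space
  by (auto elim: streams.cases)

lemma measurable_shd_random_tape [measurable]: "shd \<in> borel_measurable random_tape"
proof -
  have "shd \<in> measurable random_tape (restrict_space lborel {0..1::real})"
    unfolding random_tape_def by measurable
  then show ?thesis by (simp add: measurable_restrict_space2_iff)
qed

text \<open>Splitting off the head \<open>t\<close>, the remaining fibre is the whole space if
  \<open>t\<close> lies in \<open>A\<close> and empty otherwise, so the head has law
  \<open>M\<close>.\<close>

lemma (in prob_space) emeasure_stream_space_shd:
  assumes A: "A \<in> sets M"
  shows "emeasure (stream_space M) {\<omega> \<in> space (stream_space M). shd \<omega> \<in> A} = emeasure M A"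
proof -
  interpret S: prob_space "stream_space M" by (rule prob_space_stream_space)
  have "emeasure (stream_space M) {\<omega> \<in> space (stream_space M). shd \<omega> \<in> A} =
    (\<integral>\<^sup>+t. emeasure (stream_space M)
      {\<omega> \<in> space (stream_space M). t ## \<omega> \<in> {\<omega> \<in> space (stream_space M). shd \<omega> \<in> A}} \<partial>M)"
    by (rule emeasure_stream_space) (use A in measurable)
  also have "\<dots> = (\<integral>\<^sup>+t. indicator A t \<partial>M)"
  proof (rule nn_integral_cong)
    fix t assume "t \<in> space M"
    then have "{\<omega> \<in> space (stream_space M). t ## \<omega> \<in> {\<omega> \<in> space (stream_space M). shd \<omega> \<in> A}}
        = (if t \<in> A then space (stream_space M) else {})"
      by (auto simp: space_stream_space)
    then show "emeasure (stream_space M)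
        {\<omega> \<in> space (stream_space M). t ## \<omega> \<in> {\<omega> \<in> space (stream_space M). shd \<omega> \<in> A}}
        = indicator A t"
      by (simp add: S.emeasure_space_1)
  qed
  finally show ?thesis using A by simp
qed

lemma measure_random_tape_shd:
  assumes [measurable]: "A \<in> sets borel"
  shows "measure random_tape {\<omega> \<in> space random_tape. shd \<omega> \<in> A} = measure lborel ({0..1} \<inter> A)"
proof -
  \<comment> \<open>Heads lie in [0,1] anyway, and the trace of \<open>A\<close> on [0,1] is
    measurable in the restricted space.\<close>
  have "{\<omega> \<in> space random_tape. shd \<omega> \<in> A} = {\<omega> \<in> space random_tape. shd \<omega> \<in> {0..1} \<inter> A}"
    using shd_random_tape by auto
  moreover have "{0..1} \<inter> A \<in> sets (restrict_space lborel {0..1})"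
    by (auto simp: sets_restrict_space)
  ultimately show ?thesis
    using prob_space.emeasure_stream_space_shd[OF prob_space_unit_interval, of "{0..1} \<inter> A"]
    by (simp add: random_tape_def measure_def emeasure_restrict_space)
qed

section \<open>Threshold rounding\<close>

text \<open>The comparison is cleared of the factor \<open>d/2\<close>, which is the test that
  \<open>round_loop\<close> performs. The vertex type stays general because the function is applied
  both to vertices and to list positions.\<close>

definition round_up :: "nat \<Rightarrow> ('v \<Rightarrow> nat) \<Rightarrow> ('v \<Rightarrow> real) \<Rightarrow> real \<Rightarrow> 'v \<Rightarrow> real" where
  "round_up d \<kappa> x u v = (if real d * x v < 2 * threshold d u (\<kappa> v) then 0 else 1)"

lemma round_up_eq_indicator:
  "d > 0 \<Longrightarrow>
     round_up d \<kappa> x u v = indicator {u. threshold d u (\<kappa> v) \<le> real d / 2 * x v} u"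
  by (auto simp: round_up_def indicator_def)

lemma integral_vertex_cover_round_up:
  assumes d: "d \<ge> 2" and V: "hypergraph V B" and cover: "fractional_vertex_cover V B x"
    and u: "u \<in> {0..1}" and \<kappa>: "\<And>v. v \<in> V \<Longrightarrow> \<kappa> v \<in> {1..d}"
    and inj: "\<And>P. P \<in> B \<Longrightarrow> inj_on \<kappa> P"
  shows "integral_vertex_cover V B (round_up d \<kappa> x u)"
  unfolding integral_vertex_cover_def
proof (intro conjI ballI)
  fix P assume P: "P \<in> B"
  then have PV: "P \<subseteq> V" "finite P" using V finite_subset by (auto simp: hypergraph_def)
  have x1: "1 \<le> (\<Sum>v\<in>P. x v)" using cover P by (simp add: fractional_vertex_cover_def)
  show "1 \<le> (\<Sum>v\<in>P. round_up d \<kappa> x u v)"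
  proof (cases "\<exists>v\<in>P. round_up d \<kappa> x u v = 1")
    case True
    then obtain v where v: "v \<in> P" "round_up d \<kappa> x u v = 1" by blast
    have "round_up d \<kappa> x u v \<le> (\<Sum>v\<in>P. round_up d \<kappa> x u v)"
      by (rule member_le_sum) (use PV v in \<open>auto simp: round_up_def\<close>)
    then show ?thesis using v by simp
  next
    case False
    then have less: "real d * x v < 2 * threshold d u (\<kappa> v)" if "v \<in> P" for v
      using that by (auto simp: round_up_def split: if_splits)
    \<comment> \<open>Needed for strictness of the sum below: an empty hyperedge would have weight
      0.\<close>
    have "P \<noteq> {}" using x1 by auto
    have "real d \<le> real d * (\<Sum>v\<in>P. x v)" using x1 d by simp
    also have "\<dots> = (\<Sum>v\<in>P. real d * x v)" by (rule sum_distrib_left)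
    also have "\<dots> < (\<Sum>v\<in>P. 2 * threshold d u (\<kappa> v))"
      by (rule sum_strict_mono) (use PV \<open>P \<noteq> {}\<close> less in auto)
    \<comment> \<open>No two vertices of \<open>P\<close> share a class, so each threshold is
      counted once; classes that \<open>P\<close> misses are then added at nonnegative cost.\<close>
    also have "\<dots> = (\<Sum>i\<in>\<kappa> ` P. 2 * threshold d u i)"
      by (simp add: sum.reindex[OF inj[OF P]])
    also have "\<dots> \<le> (\<Sum>i\<in>{1..d}. 2 * threshold d u i)"
      by (rule sum_mono2) (use PV \<kappa> u threshold_nonneg in auto)
    also have "\<dots> = real d" using sum_threshold[OF d, of u] by (simp add: sum_distrib_left[symmetric])
    finally show ?thesis by simp
  qed
qed (simp add: round_up_def)

text \<open>The rounded value is the indicator of the event that the threshold, evaluated at the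
  first draw, is at most \<open>d/2 * x v\<close>, and \<open>measure_threshold_le\<close> bounds
  the probability of that event.\<close>

lemma expectation_round_up:
  assumes d: "d > 0" and x: "0 \<le> x v"
  shows "integrable random_tape (\<lambda>\<omega>. round_up d \<kappa> x (shd \<omega>) v)" (is "integrable _ ?f")
    and "(\<integral>\<omega>. round_up d \<kappa> x (shd \<omega>) v \<partial>random_tape) \<le> real d / 2 * x v"
proof -
  interpret prob_space random_tape by (rule prob_space_random_tape)
  define A where "A = {u. threshold d u (\<kappa> v) \<le> real d / 2 * x v}"
  have A [measurable]: "A \<in> sets borel" unfolding A_def by measurable
  define E where "E = {\<omega> \<in> space random_tape. shd \<omega> \<in> A}"
  have E: "E \<in> events" unfolding E_def by measurable
  have f: "?f \<omega> = indicator E \<omega>" if "\<omega> \<in> space random_tape" for \<omega>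
    using that by (simp add: round_up_eq_indicator[OF d] E_def A_def indicator_def)
  have "integrable random_tape (indicator E :: _ \<Rightarrow> real)" using E by (simp add: emeasure_eq_measure)
  also have "?this \<longleftrightarrow> integrable random_tape ?f"
    by (rule Bochner_Integration.integrable_cong) (simp_all add: f)
  finally show "integrable random_tape ?f" .
  have "(\<integral>\<omega>. ?f \<omega> \<partial>random_tape) = (\<integral>\<omega>. indicator E \<omega> \<partial>random_tape)"
    using f by (intro Bochner_Integration.integral_cong) auto
  also have "\<dots> = prob E" using E by simp
  also have "\<dots> = measure lborel ({0..1} \<inter> A)" unfolding E_def by (rule measure_random_tape_shd[OF A])
  also have "\<dots> \<le> real d / 2 * x v" unfolding A_def by (rule measure_threshold_le) (use x in simp)
  finally show "(\<integral>\<omega>. ?f \<omega> \<partial>random_tape) \<le> real d / 2 * x v" .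
qed

section \<open>The program\<close>

definition wp :: "com \<Rightarrow> state \<Rightarrow> (nat \<Rightarrow> state \<Rightarrow> bool) \<Rightarrow> bool" where
  "wp p s Q \<longleftrightarrow> (\<exists>t s'. exec p s t s' \<and> Q t s')"

lemma wp_mono: "wp p s Q \<Longrightarrow> (\<And>t s'. Q t s' \<Longrightarrow> Q' t s') \<Longrightarrow> wp p s Q'"
  unfolding wp_def by blast

text \<open>Determinism turns the existential in \<open>wp\<close> into a statement about the only
  run, so the rules for basic commands become equivalences fit for rewriting.\<close>

lemma wp_eq: "exec p s t s' \<Longrightarrow> wp p s Q \<longleftrightarrow> Q t s'"
  unfolding wp_def by (metis exec_deterministic)

lemma wp_simps [simp]:
  "wp Skip s Q \<longleftrightarrow> Q 1 s"
  "wp (IAssign a e) s Q \<longleftrightarrow> Q (1 + icost e) (s\<lparr>ivar := (ivar s)(a := ival e s)\<rparr>)"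
  "wp (RAssign a r) s Q \<longleftrightarrow> Q (1 + rcost r) (s\<lparr>rvar := (rvar s)(a := rval r s)\<rparr>)"
  "wp (IPut a i e) s Q \<longleftrightarrow> Q (1 + icost i + icost e)
     (s\<lparr>iarr := (iarr s)(a := (iarr s a)(ival i s := ival e s))\<rparr>)"
  "wp (RPut a i r) s Q \<longleftrightarrow> Q (1 + icost i + rcost r)
     (s\<lparr>rarr := (rarr s)(a := (rarr s a)(ival i s := rval r s))\<rparr>)"
  "wp (Sample a) s Q \<longleftrightarrow>
     Q 1 (s\<lparr>rvar := (rvar s)(a := shd (tape s)), tape := stl (tape s)\<rparr>)"
  by (rule wp_eq, rule exec.intros)+

lemma wp_Seq [simp]: "wp (Seq p q) s Q \<longleftrightarrow> wp p s (\<lambda>t s'. wp q s' (\<lambda>t' s''. Q (t + t') s''))"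
  unfolding wp_def by (blast elim!: exec_SeqE intro: exec.intros)

lemma wp_If [simp]:
  "wp (If b p q) s Q \<longleftrightarrow> wp (if bval b s then p else q) s (\<lambda>t s'. Q (1 + bcost b + t) s')"
proof -
  let ?r = "if bval b s then p else q"
  have "exec (If b p q) s u s' \<longleftrightarrow> (\<exists>t. u = 1 + bcost b + t \<and> exec ?r s t s')" for u s'
  proof
    assume "exec (If b p q) s u s'"
    then show "\<exists>t. u = 1 + bcost b + t \<and> exec ?r s t s'" by (rule exec_IfE) auto
  next
    assume "\<exists>t. u = 1 + bcost b + t \<and> exec ?r s t s'"
    then show "exec (If b p q) s u s'" using IfTrue IfFalse by (metis (full_types))
  qed
  then show ?thesis unfolding wp_def by auto
qed

text \<open>The index \<open>k\<close> bounds the number of iterations left. It need only decrease,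
  so a loop may count down by two. The final summand of the bound pays for the failing test.\<close>

lemma wp_While:
  assumes body: "\<And>k s. I k s \<Longrightarrow> bval b s \<Longrightarrow> wp p s (\<lambda>t s'. t \<le> T \<and> (\<exists>k'<k. I k' s'))"
    and "I k s"
  shows "wp (While b p) s
    (\<lambda>t s'. t \<le> (1 + bcost b + T) * k + (1 + bcost b) \<and> (\<exists>k'. I k' s') \<and> \<not> bval b s')"
  using \<open>I k s\<close>
proof (induction k arbitrary: s rule: less_induct)
  case (less k)
  show ?case
  proof (cases "bval b s")
    case False
    then show ?thesis unfolding wp_def using less.prems
      by (intro exI conjI) (auto intro: WhileFalse)
  next
    case True
    from body[OF less.prems True] obtain t s' k'
      where 1: "exec p s t s'" "t \<le> T" "k' < k" "I k' s'"
      unfolding wp_def by blast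
    from less.IH[OF 1(3,4)] obtain t' s'' where 2: "exec (While b p) s' t' s''"
        "t' \<le> (1 + bcost b + T) * k' + (1 + bcost b)" "\<exists>k'. I k' s''" "\<not> bval b s''"
      unfolding wp_def by blast
    have "(1 + bcost b + T) * Suc k' \<le> (1 + bcost b + T) * k" using 1 by (intro mult_left_mono) auto
    then have "1 + bcost b + t + t' \<le> (1 + bcost b + T) * k + (1 + bcost b)" using 1 2 by simp
    then show ?thesis unfolding wp_def using WhileTrue[OF True 1(1) 2(1)] 2 by blast
  qed
qed

section \<open>The program and its three phases\<close>

abbreviation "num k \<equiv> ROfNat (INum k)"

text \<open>Counting down by two leaves \<open>d mod 2\<close> in \<open>k\<close>, although the
  language has no parity test. For odd \<open>d\<close> at least 3, classes 2 and 3 receive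
  provisional values.\<close>

definition pair_loop :: com where
  "pair_loop = While (ILess (INum 1) (IVar ''k''))
     (Seq (RPut ''t'' (IVar ''k'') (RVar ''u''))
     (Seq (RPut ''t'' (ISub (IVar ''k'') (INum 1)) (RSub (num 1) (RVar ''u'')))
          (IAssign ''k'' (ISub (IVar ''k'') (INum 2)))))"

text \<open>After \<open>pair_loop\<close>, the test \<open>0 < k\<close> asks whether
  \<open>d\<close> is odd.\<close>

definition fix_triple :: com where
  "fix_triple = If (ILess (INum 0) (IVar ''k''))
     (Seq (RPut ''t'' (INum 1) (RVar ''u''))
          (If (RLess (RVar ''u'') (RDiv (num 1) (num 2)))
            (Seq (RPut ''t'' (INum 2) (RAdd (RVar ''u'') (RDiv (num 1) (num 2))))
                 (RPut ''t'' (INum 3) (RSub (num 1) (RMul (num 2) (RVar ''u'')))))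
            (Seq (RPut ''t'' (INum 2) (RSub (RVar ''u'') (RDiv (num 1) (num 2))))
                 (RPut ''t'' (INum 3) (RSub (num 2) (RMul (num 2) (RVar ''u'')))))))
     Skip"

definition round_loop :: com where
  "round_loop = While (ILess (IVar ''j'') (IVar ''n''))
     (Seq (If (RLess (RMul (ROfNat (IVar ''d'')) (RGet ''x'' (IVar ''j'')))
                     (RMul (num 2) (RGet ''t'' (IGet ''part'' (IVar ''j'')))))
            (IPut ''xbar'' (IVar ''j'') (INum 0))
            (IPut ''xbar'' (IVar ''j'') (INum 1)))
          (IAssign ''j'' (IAdd (IVar ''j'') (INum 1))))"

definition rounding :: com where
  "rounding = Seq (Sample ''u'') (Seq (IAssign ''k'' (IVar ''d''))
     (Seq pair_loop (Seq fix_triple round_loop)))"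

text \<open>What the first two phases must preserve for \<open>round_loop\<close>. That loop does
  not initialise \<open>j\<close>; its start at 0 comes from the zeroed cells of the input
  state.\<close>

definition frame :: "nat \<Rightarrow> nat \<Rightarrow> (nat \<Rightarrow> nat) \<Rightarrow> (nat \<Rightarrow> real) \<Rightarrow> real \<Rightarrow> state \<Rightarrow> bool" where
  "frame n d \<pi> y u s \<longleftrightarrow> ivar s ''n'' = n \<and> ivar s ''d'' = d \<and> ivar s ''j'' = 0 \<and>
     iarr s ''part'' = \<pi> \<and> rarr s ''x'' = y \<and> rvar s ''u'' = u"

section \<open>Correctness and cost of each phase\<close>

lemma wp_pair_loop:
  assumes "frame n d \<pi> y u s" "ivar s ''k'' = d"
  shows "wp pair_loop s (\<lambda>t s'. t \<le> 20 * d + 4 \<and> frame n d \<pi> y u s' \<and>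
     ivar s' ''k'' = d mod 2 \<and>
     (\<forall>i. d mod 2 < i \<and> i \<le> d \<longrightarrow> rarr s' ''t'' i = (if even (d + i) then u else 1 - u)))"
proof -
  \<comment> \<open>The counter itself serves as the variant. The conjunct
    \<open>even (d + k)\<close> identifies its exit value, 0 or 1, as
    \<open>d mod 2\<close>.\<close>
  define I where "I k s \<longleftrightarrow> k \<le> d \<and> even (d + k) \<and> frame n d \<pi> y u s \<and> ivar s ''k'' = k \<and>
     (\<forall>i. k < i \<and> i \<le> d \<longrightarrow> rarr s ''t'' i = (if even (d + i) then u else 1 - u))" for k and s :: state
  \<comment> \<open>The body costs 15, at most 16; with 4 for each test this gives
    \<open>20 * d + 4\<close>.\<close>
  have "wp pair_loop s (\<lambda>t s'. t \<le> (1 + bcost (ILess (INum 1) (IVar ''k'')) + 16) * d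
      + (1 + bcost (ILess (INum 1) (IVar ''k''))) \<and> (\<exists>k'. I k' s') \<and>
      \<not> bval (ILess (INum 1) (IVar ''k'')) s')"
    unfolding pair_loop_def
  proof (rule wp_While)
    show "I d s" using assms by (auto simp: I_def)
    fix k s assume I: "I k s" and "bval (ILess (INum 1) (IVar ''k'')) s"
    then have k: "k > 1" by (simp add: I_def)
    have step: "i = k - 1 \<or> i = k \<or> k < i" if "k - 2 < i" for i using that k by linarith
    show "wp (Seq (RPut ''t'' (IVar ''k'') (RVar ''u''))
     (Seq (RPut ''t'' (ISub (IVar ''k'') (INum 1)) (RSub (num 1) (RVar ''u'')))
          (IAssign ''k'' (ISub (IVar ''k'') (INum 2))))) s (\<lambda>t s'. t \<le> 16 \<and> (\<exists>k'<k. I k' s'))"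
      using I k by (auto simp: I_def frame_def dest!: step intro!: exI[of _ "k - 2"])
  qed
  then show ?thesis
  proof (rule wp_mono, goal_cases)
    case (1 t s')
    then obtain k where k: "I k s'" "k \<le> 1" by (auto simp: I_def)
    then have "k = d mod 2"
      using odd_iff_mod_2_eq_one[of d] by (cases k) (auto simp: I_def elim: evenE)
    with k 1 show ?case by (auto simp: I_def)
  qed
qed

text \<open>For even \<open>d\<close> the pairing already gives all thresholds. For odd
  \<open>d\<close> it gives those above 3, and the first three cells are overwritten.\<close>

lemma wp_fix_triple:
  assumes "frame n d \<pi> y u s" "ivar s ''k'' = d mod 2" "d \<ge> 2"
    "\<forall>i. d mod 2 < i \<and> i \<le> d \<longrightarrow> rarr s ''t'' i = (if even (d + i) then u else 1 - u)"
  shows "wp fix_triple s (\<lambda>t s'. t \<le> 50 \<and> frame n d \<pi> y u s' \<and>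
     (\<forall>i\<in>{1..d}. rarr s' ''t'' i = threshold d u i))"
proof (cases "even d")
  case True
  have "rarr s ''t'' i = threshold d u i" if "i \<in> {1..d}" for i
    using assms(4) True that by (auto simp: threshold_def)
  moreover have "ivar s ''k'' = 0" using True assms(2) by simp
  ultimately show ?thesis using assms(1) by (simp add: fix_triple_def)
next
  case False
  then have k: "ivar s ''k'' = 1" "d mod 2 = 1" using assms(2) by presburger+
  have high: "rarr s ''t'' i = threshold d u i" if "3 < i" "i \<le> d" for i
    using assms(4) False k(2) that by (simp add: threshold_def)
  have triple: "threshold d u 1 = u"
      "threshold d u 2 = (if u < 1/2 then u + 1/2 else u - 1/2)"
      "threshold d u 3 = (if u < 1/2 then 1 - 2 * u else 2 - 2 * u)"
    using False by (simp_all add: threshold_def)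
  have "\<forall>i\<in>{1..d}. ((rarr s ''t'')(1 := threshold d u 1, 2 := threshold d u 2,
      3 := threshold d u 3)) i = threshold d u i"
  proof
    fix i assume "i \<in> {1..d}"
    then consider "i = 1" | "i = 2" | "i = 3" | "3 < i" "i \<le> d" by fastforce
    then show "((rarr s ''t'')(1 := threshold d u 1, 2 := threshold d u 2,
      3 := threshold d u 3)) i = threshold d u i"
      by cases (simp_all add: high)
  qed
  moreover have "wp fix_triple s (\<lambda>t s'. t \<le> 50 \<and> frame n d \<pi> y u s' \<and>
      rarr s' ''t'' = (rarr s ''t'')(1 := threshold d u 1, 2 := threshold d u 2,
        3 := threshold d u 3))"
    using assms(1) k(1) unfolding triple fix_triple_def frame_def
    by (cases "u < 1/2") simp_all
  ultimately show ?thesis by (elim wp_mono) simp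
qed

lemma wp_round_loop:
  assumes "frame n d \<pi> y u s" "\<forall>i\<in>{1..d}. rarr s ''t'' i = threshold d u i"
    "\<forall>j<n. \<pi> j \<in> {1..d}"
  shows "wp round_loop s (\<lambda>t s'. t \<le> 30 * n + 4 \<and>
     (\<forall>j<n. real (iarr s' ''xbar'' j) = round_up d \<pi> y u j))"
proof -
  \<comment> \<open>Here \<open>k\<close> counts the positions still to be processed, turning the
    increasing \<open>j\<close> into a decreasing variant.\<close>
  define I where "I k s \<longleftrightarrow> k \<le> n \<and> ivar s ''j'' = n - k \<and> ivar s ''n'' = n \<and> ivar s ''d'' = d \<and>
     iarr s ''part'' = \<pi> \<and> rarr s ''x'' = y \<and> (\<forall>i\<in>{1..d}. rarr s ''t'' i = threshold d u i) \<and>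
     (\<forall>j<n - k. real (iarr s ''xbar'' j) = round_up d \<pi> y u j)" for k and s :: state
  define b where "b = ILess (IVar ''j'') (IVar ''n'')"
  have "wp round_loop s (\<lambda>t s'. t \<le> (1 + bcost b + 26) * n + (1 + bcost b) \<and> (\<exists>k'. I k' s') \<and>
      \<not> bval b s')"
    unfolding round_loop_def b_def
  proof (rule wp_While, fold b_def)
    show "I n s" using assms by (auto simp: I_def frame_def)
    fix k s assume I: "I k s" and b: "bval b s"
    then have "k > 0" "k \<le> n" by (auto simp: I_def b_def)
    then obtain k' m where k': "k = Suc k'" "k' \<le> n" "n - k = m" "n - k' = Suc m" "m < n"
      by (intro that[of "k - 1" "n - k"]) auto
    have \<pi>: "\<pi> m \<in> {1..d}" using assms(3) k' by auto
    have s: "ivar s ''j'' = m" "ivar s ''n'' = n" "ivar s ''d'' = d" "iarr s ''part'' = \<pi>"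
        "rarr s ''x'' = y" "rarr s ''t'' (\<pi> m) = threshold d u (\<pi> m)"
        "\<forall>i\<in>{1..d}. rarr s ''t'' i = threshold d u i"
        "\<forall>j<m. real (iarr s ''xbar'' j) = round_up d \<pi> y u j"
      using I \<pi> k' by (auto simp: I_def)
    have "wp (Seq (If (RLess (RMul (ROfNat (IVar ''d'')) (RGet ''x'' (IVar ''j'')))
                     (RMul (num 2) (RGet ''t'' (IGet ''part'' (IVar ''j'')))))
            (IPut ''xbar'' (IVar ''j'') (INum 0))
            (IPut ''xbar'' (IVar ''j'') (INum 1)))
          (IAssign ''j'' (IAdd (IVar ''j'') (INum 1)))) s (\<lambda>t s'. t \<le> 26 \<and> I k' s')"
      using s k' by (simp add: I_def round_up_def less_Suc_eq)
    then show "wp (Seq (If (RLess (RMul (ROfNat (IVar ''d'')) (RGet ''x'' (IVar ''j'')))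
                     (RMul (num 2) (RGet ''t'' (IGet ''part'' (IVar ''j'')))))
            (IPut ''xbar'' (IVar ''j'') (INum 0))
            (IPut ''xbar'' (IVar ''j'') (INum 1)))
          (IAssign ''j'' (IAdd (IVar ''j'') (INum 1)))) s (\<lambda>t s'. t \<le> 26 \<and> (\<exists>k'<k. I k' s'))"
      by (rule wp_mono) (use k' in blast)
  qed
  then show ?thesis
  proof (rule wp_mono, goal_cases)
    case (1 t s')
    then obtain k where k: "I k s'" by blast
    \<comment> \<open>A failing test says that the processed prefix, of length \<open>n - k\<close>,
      already has length \<open>n\<close>.\<close>
    moreover from this 1 have "\<not> n - k < n" unfolding I_def b_def by simp
    then have "n - k = n" by linarith
    ultimately have "\<forall>j<n. real (iarr s' ''xbar'' j) = round_up d \<pi> y u j"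
      unfolding I_def by metis
    with 1 show ?case by (simp add: b_def)
  qed
qed

section \<open>The complete run and the expected cost\<close>

definition class_of :: "nat \<Rightarrow> (nat \<Rightarrow> 'v set) \<Rightarrow> 'v \<Rightarrow> nat" where
  "class_of d Vs v = (THE i. i \<in> {1..d} \<and> v \<in> Vs i)"

lemma class_of:
  assumes "d_partition d V B Vs" "v \<in> V"
  shows "class_of d Vs v \<in> {1..d}" "v \<in> Vs (class_of d Vs v)"
proof -
  have "\<exists>!i. i \<in> {1..d} \<and> v \<in> Vs i"
    using assms unfolding d_partition_def disjoint_family_on_def by blast
  from theI'[OF this]
  show "class_of d Vs v \<in> {1..d}" "v \<in> Vs (class_of d Vs v)" by (simp_all add: class_of_def)
qed

lemma wp_rounding:
  assumes "d \<ge> 2" "\<And>j. j < length vs \<Longrightarrow> class_of d Vs (vs ! j) \<in> {1..d}"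
  shows "wp rounding (input_state d vs Vs c x \<omega>) (\<lambda>t s. t \<le> 100 * (length vs + d) \<and>
    outputs s vs (round_up d (class_of d Vs) x (shd \<omega>)))"
proof -
  let ?s0 = "input_state d vs Vs c x \<omega>"
  define n where "n = length vs"
  define u where "u = shd \<omega>"
  define \<pi> where "\<pi> = iarr ?s0 ''part''"
  define y where "y = rarr ?s0 ''x''"
  define s where "s = ?s0\<lparr>rvar := (rvar ?s0)(''u'' := u), tape := stl \<omega>,
    ivar := (ivar ?s0)(''k'' := d)\<rparr>"
  \<comment> \<open>\<open>class_of\<close> repeats the description used in
    \<open>input_state\<close>, so rounding position \<open>j\<close> agrees with rounding the
    vertex \<open>vs ! j\<close>.\<close>
  have input: "\<pi> j = class_of d Vs (vs ! j)" "y j = x (vs ! j)" if "j < n" for j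
    using that by (simp_all add: \<pi>_def y_def input_state_def n_def class_of_def)
  have \<pi>: "\<forall>j<n. \<pi> j \<in> {1..d}" using assms(2) input(1) by (simp add: n_def)
  have s: "frame n d \<pi> y u s" "ivar s ''k'' = d"
    by (simp_all add: frame_def s_def \<pi>_def y_def input_state_def n_def)
  \<comment> \<open>The constant is 58 = 4 + 50 + 4, collected from the three phases.\<close>
  define Q where "Q t s' \<longleftrightarrow> t \<le> 20 * d + 30 * n + 58 \<and>
      (\<forall>j<n. real (iarr s' ''xbar'' j) = round_up d \<pi> y u j)" for t :: nat and s' :: state
  define R where "R t s' \<longleftrightarrow> t \<le> 100 * (length vs + d) \<and>
      outputs s' vs (round_up d (class_of d Vs) x (shd \<omega>))" for t s'
  have "wp (Seq pair_loop (Seq fix_triple round_loop)) s Q"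
    unfolding wp_Seq
  proof (rule wp_mono[OF wp_pair_loop[OF s]])
    fix t1 s1
    assume 1: "t1 \<le> 20 * d + 4 \<and> frame n d \<pi> y u s1 \<and> ivar s1 ''k'' = d mod 2 \<and>
      (\<forall>i. d mod 2 < i \<and> i \<le> d \<longrightarrow> rarr s1 ''t'' i = (if even (d + i) then u else 1 - u))"
    then have "wp fix_triple s1 (\<lambda>t s'. t \<le> 50 \<and> frame n d \<pi> y u s' \<and>
        (\<forall>i\<in>{1..d}. rarr s' ''t'' i = threshold d u i))"
      using assms(1) by (blast intro: wp_fix_triple)
    then show "wp fix_triple s1 (\<lambda>t2 s2. wp round_loop s2 (\<lambda>t3 s3. Q (t1 + (t2 + t3)) s3))"
    proof (rule wp_mono)
      fix t2 :: nat and s2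
      assume 2: "t2 \<le> 50 \<and> frame n d \<pi> y u s2 \<and>
        (\<forall>i\<in>{1..d}. rarr s2 ''t'' i = threshold d u i)"
      then have "wp round_loop s2 (\<lambda>t s'. t \<le> 30 * n + 4 \<and>
          (\<forall>j<n. real (iarr s' ''xbar'' j) = round_up d \<pi> y u j))"
        using \<pi> by (blast intro: wp_round_loop)
      then show "wp round_loop s2 (\<lambda>t3 s3. Q (t1 + (t2 + t3)) s3)"
        by (rule wp_mono) (use 1 2 in \<open>auto simp: Q_def\<close>)
    qed
  qed
  then have "wp (Seq pair_loop (Seq fix_triple round_loop)) s (\<lambda>t. R (1 + (2 + t)))"
  proof (rule wp_mono)
    fix t s'
    assume *: "Q t s'"
    \<comment> \<open>The draw costs 1 and the assignment to \<open>k\<close> costs 2; since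
      \<open>d\<close> is at least 2, the slack \<open>80 * d\<close> absorbs the total constant
      61.\<close>
    have "1 + (2 + t) \<le> 100 * (length vs + d)"
      using * assms(1) by (simp add: Q_def n_def)
    moreover have "outputs s' vs (round_up d (class_of d Vs) x (shd \<omega>))"
      using * input by (simp add: Q_def outputs_def n_def[symmetric] round_up_def u_def)
    ultimately show "R (1 + (2 + t)) s'" by (simp add: R_def)
  qed
  moreover have "1 + icost (IVar ''d'') = 2" by simp
  moreover have "?s0\<lparr>rvar := (rvar ?s0)(''u'' := shd (tape ?s0)), tape := stl (tape ?s0)\<rparr>
      \<lparr>ivar := (ivar ?s0)(''k'' := d)\<rparr> = s"
    by (simp add: s_def u_def input_state_def)
  moreover have "ivar ?s0 ''d'' = d" by (simp add: input_state_def)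
  ultimately show ?thesis
    unfolding R_def[symmetric] rounding_def wp_Seq[of "Sample _"] wp_Seq[of "IAssign _ _"] wp_simps
    by (simp del: wp_Seq)
qed

text \<open>Linearity of expectation reduces the cost bound to single vertices, so it does no harm
  that all thresholds come from one random number. Coverage and running time hold for every tape,
  not just almost surely.\<close>

theorem theorem11:
  "\<exists>(prog :: com) (K :: nat).
     \<forall>(d :: nat) (V :: nat set) (B :: nat set set) (Vs :: nat \<Rightarrow> nat set)
      (c :: nat \<Rightarrow> real) (x :: nat \<Rightarrow> real) (vs :: nat list).
       d \<ge> 2 \<longrightarrow>
       hypergraph V B \<longrightarrow>
       d_partition d V B Vs \<longrightarrow>
       (\<forall>v\<in>V. 0 \<le> c v) \<longrightarrow>
       fractional_vertex_cover V B x \<longrightarrow>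
       distinct vs \<longrightarrow> set vs = V \<longrightarrow>
       (\<exists>xbar :: real stream \<Rightarrow> nat \<Rightarrow> real.
          (\<forall>\<omega>\<in>space random_tape.
             (\<exists>t s. exec prog (input_state d vs Vs c x \<omega>) t s \<and>
                t \<le> K * (card V + d) \<and> outputs s vs (xbar \<omega>)) \<and>
             integral_vertex_cover V B (xbar \<omega>)) \<and>
          integrable random_tape (\<lambda>\<omega>. \<Sum>v\<in>V. c v * xbar \<omega> v) \<and>
          (\<integral>\<omega>. (\<Sum>v\<in>V. c v * xbar \<omega> v) \<partial>random_tape) \<le> real d / 2 * (\<Sum>v\<in>V. c v * x v))"
proof (intro exI[of _ rounding] exI[of _ 100] allI impI)
  fix d V B Vs vs and c x :: "nat \<Rightarrow> real"
  assume d: "d \<ge> 2" and V: "hypergraph V B" and part: "d_partition d V B Vs"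
    and c: "\<forall>v\<in>V. 0 \<le> c v" and x: "fractional_vertex_cover V B x"
    and vs: "distinct vs" "set vs = V"
  define \<kappa> where "\<kappa> = class_of d Vs"
  note \<kappa> = class_of[OF part, folded \<kappa>_def]
  have inj: "inj_on \<kappa> P" if P: "P \<in> B" for P
  proof (rule inj_onI)
    fix v w assume vw: "v \<in> P" "w \<in> P" "\<kappa> v = \<kappa> w"
    have PV: "P \<subseteq> V" "finite P" using V P finite_subset by (auto simp: hypergraph_def)
    then have "v \<in> P \<inter> Vs (\<kappa> v)" "w \<in> P \<inter> Vs (\<kappa> v)" "\<kappa> v \<in> {1..d}"
      using \<kappa>[of v] \<kappa>[of w] vw by auto
    moreover from this have "card (P \<inter> Vs (\<kappa> v)) \<le> Suc 0"
      using part P by (simp add: d_partition_def)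
    \<comment> \<open>Finiteness of \<open>P\<close> matters: \<open>card\<close> is 0 on infinite
      sets, so the bound alone would not force \<open>v = w\<close>.\<close>
    ultimately show "v = w" using PV by (auto simp: card_le_Suc0_iff_eq)
  qed
  have n: "length vs = card V" using vs distinct_card by metis
  define xbar where "xbar = (\<lambda>\<omega>. round_up d \<kappa> x (shd \<omega>))"
  have x0: "0 \<le> x v" if "v \<in> V" for v using x that by (simp add: fractional_vertex_cover_def)
  have int: "integrable random_tape (\<lambda>\<omega>. xbar \<omega> v)" if "v \<in> V" for v
    unfolding xbar_def by (rule expectation_round_up) (use d x0 that in auto)
  have "(\<integral>\<omega>. (\<Sum>v\<in>V. c v * xbar \<omega> v) \<partial>random_tape) =
      (\<Sum>v\<in>V. c v * (\<integral>\<omega>. xbar \<omega> v \<partial>random_tape))"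
    using int by (subst Bochner_Integration.integral_sum) auto
  also have "\<dots> \<le> (\<Sum>v\<in>V. c v * (real d / 2 * x v))"
    unfolding xbar_def
    by (intro sum_mono mult_left_mono expectation_round_up) (use d x0 c in auto)
  also have "\<dots> = real d / 2 * (\<Sum>v\<in>V. c v * x v)"
    by (simp add: sum_distrib_left mult.left_commute)
  finally have expectation: "(\<integral>\<omega>. (\<Sum>v\<in>V. c v * xbar \<omega> v) \<partial>random_tape) \<le> \<dots>" .
  have run: "\<exists>t s. exec rounding (input_state d vs Vs c x \<omega>) t s \<and>
      t \<le> 100 * (card V + d) \<and> outputs s vs (xbar \<omega>)" for \<omega>
    using wp_rounding[OF d class_of(1)[OF part], of vs c x \<omega>] vs nth_mem[of _ vs]
    unfolding wp_def xbar_def \<kappa>_def n[symmetric] by simp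
  have cover: "integral_vertex_cover V B (xbar \<omega>)" if "\<omega> \<in> space random_tape" for \<omega>
    unfolding xbar_def
    by (rule integral_vertex_cover_round_up) (use d V x \<kappa> inj shd_random_tape[OF that] in auto)
  have integrable: "integrable random_tape (\<lambda>\<omega>. \<Sum>v\<in>V. c v * xbar \<omega> v)"
    using int by (intro Bochner_Integration.integrable_sum) auto
  show "\<exists>xbar. (\<forall>\<omega>\<in>space random_tape.
        (\<exists>t s. exec rounding (input_state d vs Vs c x \<omega>) t s \<and>
           t \<le> 100 * (card V + d) \<and> outputs s vs (xbar \<omega>)) \<and>
        integral_vertex_cover V B (xbar \<omega>)) \<and>
      integrable random_tape (\<lambda>\<omega>. \<Sum>v\<in>V. c v * xbar \<omega> v) \<and>
      (\<integral>\<omega>. (\<Sum>v\<in>V. c v * xbar \<omega> v) \<partial>random_tape) \<le> real d / 2 * (\<Sum>v\<in>V. c v * x v)"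
    using run cover integrable expectation by blast
qed

end
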